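(* Let $WP$ denote the Wiener polynomial of a tree and $PWP$ the partial Wiener polynomial of a rooted tree with respect to its root (polynomials in $x$), and write $S(n)=S(\tau(n))$ for each of these statistics $S$, where $\tau(n)$ is the rooted tree with Matula number $n$. Then for every positive integer $n$, $$WP(n)=\begin{cases}0, & \text{if } n=1;\\ WP(t)+x\,PWP(t)+x, & \text{if } n=p_t \text{ with } t\ge 1;\\ WP(r)+WP(s)+PWP(r)\,PWP(s), & \text{if } n=rs \text{ with } r,s\ge 2.\end{cases}$$
   Context: For $m\ge 1$ let $p_m$ denote the $m$-th prime ($p_1=2,p_2=3,p_3=5,\dots$). Rooted trees are finite and considered up to isomorphism of rooted trees. The Matula number $\mu(T)$ of a rooted tree $T$ is defined recursively: $\mu(T)=1$ for the one-vertex tree; otherwise, if $T_1,\dots,T_d$ are the subtrees rooted at the vertices adjacent to the root of $T$, then $\mu(T)=p_{\mu(T_1)}p_{\mu(T_2)}\cdots p_{\mu(T_d)}$. The map $\mu$ is a bijection from rooted trees to positive integers, and $\tau(n)$ denotes the rooted tree with Matula number $n$. Equivalently: $\tau(1)$ is the one-vertex tree; $\tau(p_t)$ is obtained from $\tau(t)$ by adding a new vertex, which becomes the root, joined by an edge to the root of $\tau(t)$; and, for $r,s\ge 2$, $\tau(rs)$ is obtained from $\tau(r)$ and $\tau(s)$ by identifying their roots. For a statistic $S$ on rooted trees, $S(n)$ means $S(\tau(n))$. The Wiener polynomial of a tree $T$ is $\sum x^{d(i,j)}$, the sum being over all unordered pairs of distinct vertices $i,j$ of $T$, where $d(i,j)$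 is the distance in $T$. The partial Wiener polynomial of $T$ with respect to a vertex $w$ is $\sum_i x^{d(i,w)}$, the sum being over all vertices $i$ of $T$ distinct from $w$. *)

theory Defs
  imports
    "HOL-Library.Infinite_Set"
    "HOL-Computational_Algebra.Primes"
    "HOL-Computational_Algebra.Polynomial"
begin

section \<open>Rooted trees\<close>

text \<open>A simple undirected graph with a distinguished vertex; edges are two-element sets of
  vertices.\<close>

record 'a rgraph =
  rverts :: "'a set"
  redges :: "'a set set"
  rroot :: 'a

definition walk :: "'a rgraph \<Rightarrow> 'a \<Rightarrow> 'a list \<Rightarrow> 'a \<Rightarrow> bool" where
  "walk T u xs v \<longleftrightarrow>
     xs \<noteq> [] \<and> hd xs = u \<and> last xs = v \<and> set xs \<subseteq> rverts T \<and>
     successively (\<lambda>a b. {a, b} \<in> redges T) xs"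

definition is_cycle :: "'a rgraph \<Rightarrow> 'a list \<Rightarrow> bool" where
  "is_cycle T xs \<longleftrightarrow>
     length xs \<ge> 3 \<and> distinct xs \<and> walk T (hd xs) xs (last xs) \<and> {last xs, hd xs} \<in> redges T"

definition rooted_tree :: "'a rgraph \<Rightarrow> bool" where
  "rooted_tree T \<longleftrightarrow>
     finite (rverts T) \<and> rroot T \<in> rverts T \<and>
     (\<forall>e\<in>redges T. e \<subseteq> rverts T \<and> card e = 2) \<and>
     (\<forall>u\<in>rverts T. \<forall>v\<in>rverts T. \<exists>xs. walk T u xs v) \<and>
     (\<nexists>xs. is_cycle T xs)"

text \<open>A walk visiting \<open>k + 1\<close> vertices (with multiplicity) has length \<open>k\<close>.\<close>

definition distance :: "'a rgraph \<Rightarrow> 'a \<Rightarrow> 'a \<Rightarrow> nat" where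
  "distance T u v = (LEAST k. \<exists>xs. walk T u xs v \<and> length xs = Suc k)"

section \<open>Matula numbers\<close>

definition nth_prime :: "nat \<Rightarrow> nat" where
  "nth_prime m = enumerate {p. prime p} (m - 1)"  \<comment> \<open>used for \<open>m \<ge> 1\<close> only; \<open>nth_prime 1 = 2\<close>\<close>

definition root_neighbours :: "'a rgraph \<Rightarrow> 'a set" where
  "root_neighbours T = {v \<in> rverts T. {rroot T, v} \<in> redges T}"

text \<open>The subtree rooted at a neighbour \<open>v\<close> of the root: the component of \<open>v\<close> after deletion of
  the root.\<close>

definition subtree_at :: "'a rgraph \<Rightarrow> 'a \<Rightarrow> 'a rgraph" where
  "subtree_at T v =
     (let W = {w. \<exists>xs. walk T v xs w \<and> rroot T \<notin> set xs}
      in \<lparr>rverts = W, redges = {e \<in> redges T. e \<subseteq> W}, rroot = v\<rparr>)"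

lemma card_rverts_subtree_at:
  assumes "rooted_tree T"
  shows "card (rverts (subtree_at T v)) < card (rverts T)"
proof (rule psubset_card_mono)
  show "finite (rverts T)"
    using assms by (simp add: rooted_tree_def)
  have "w \<in> rverts T \<and> w \<noteq> rroot T" if "w \<in> rverts (subtree_at T v)" for w
    using that last_in_set unfolding subtree_at_def walk_def by (fastforce simp: Let_def)
  moreover have "rroot T \<in> rverts T"
    using assms by (simp add: rooted_tree_def)
  ultimately show "rverts (subtree_at T v) \<subset> rverts T"
    by blast
qed

text \<open>The value \<open>0\<close> outside rooted trees is a dummy; it is not a Matula number.\<close>

function matula :: "'a rgraph \<Rightarrow> nat" where
  "matula T =
     (if \<not> rooted_tree T then 0
      else if rverts T = {rroot T} then 1
      else (\<Prod>v\<in>root_neighbours T. nth_prime (matula (subtree_at T v))))"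
  by pat_completeness auto
termination
  by (relation "measure (\<lambda>T. card (rverts T))") (auto simp: card_rverts_subtree_at)

declare matula.simps [simp del]

text \<open>Every finite rooted tree is isomorphic to one with vertices in \<open>nat\<close>, and the Matula number
  determines a rooted tree up to isomorphism. So \<open>tree_of n\<close> is a representative of the
  isomorphism class with Matula number \<open>n\<close>, for \<open>n \<ge> 1\<close>.\<close>

definition tree_of :: "nat \<Rightarrow> nat rgraph" where
  "tree_of n = (SOME T. rooted_tree T \<and> matula T = n)"

section \<open>Wiener polynomials\<close>

text \<open>Each unordered pair of distinct vertices is counted once, as the ordered pair with
  \<open>i < j\<close>.\<close>

definition wiener_poly :: "'a::linorder rgraph \<Rightarrow> int poly" where
  "wiener_poly T =
     (\<Sum>(i, j) \<in> {(i, j). i \<in> rverts T \<and> j \<in> rverts T \<and> i < j}. monom 1 (distance T i j))"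

definition partial_wiener_poly :: "'a rgraph \<Rightarrow> 'a \<Rightarrow> int poly" where
  "partial_wiener_poly T w = (\<Sum>i \<in> rverts T - {w}. monom 1 (distance T i w))"

definition WP :: "nat \<Rightarrow> int poly" where
  "WP n = wiener_poly (tree_of n)"

definition PWP :: "nat \<Rightarrow> int poly" where
  "PWP n = partial_wiener_poly (tree_of n) (rroot (tree_of n))"

end

theory Submission
  imports Defs
begin

text \<open>Everything rests on one operation: grafting a tree \<open>T\<close> onto a disjoint tree \<open>S\<close> by an edge
  between the two roots, the root of \<open>S\<close> becoming the root of the result. The root gains one
  neighbour, whose subtree is \<open>T\<close>, so the Matula number of the graft is \<open>\<mu>(S) p\<^bsub>\<mu>(T)\<^esub>\<close>
  (\<open>matula_graft\<close>). Distances inside each part stay the same, and a path from one part to the other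
  must use the new edge (\<open>distance_graft\<close>, \<open>distance_graft_right\<close>). Hence, with \<open>Q\<close> the partial
  Wiener polynomial at the root and \<open>W\<close> the Wiener polynomial, the graft has
  \<open>Q = Q(S) + x (1 + Q(T))\<close> and \<open>W = W(S) + W(T) + x (1 + Q(S)) (1 + Q(T))\<close>; here \<open>1 + Q\<close> is the
  generating polynomial of the distances of all vertices from the root.

  Conversely, every tree is a graft at each neighbour of its root (\<open>rooted_tree_as_graft\<close>), and for
  each prime factor \<open>p\<^sub>t\<close> of its Matula number the part grafted on can be chosen with Matula
  number \<open>t\<close> (\<open>graft_of_prime_factor\<close>). By induction, the Matula number therefore determines \<open>Q\<close> and
  \<open>W\<close> (\<open>matula_determines_polys\<close>), without any appeal to isomorphisms. Grafting also builds a tree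
  for each positive integer (\<open>ex_tree_matula\<close>). So the chosen representatives obey the two graft
  formulas as recursions from \<open>m\<close> and \<open>t\<close> to \<open>m p\<^sub>t\<close> (\<open>polys_mult_nth_prime\<close>).

  The case \<open>m = 1\<close> is the prime case of the theorem. The product case follows by splitting off the
  prime factors of \<open>s\<close> one at a time: \<open>Q\<close> turns out to be additive over products, and the
  cross terms of the successive grafts account for \<open>Q(r) Q(s)\<close> (\<open>polys_mult\<close>).\<close>

section \<open>Walks and distances\<close>

lemma walk_single: "u \<in> rverts T \<Longrightarrow> walk T u [u] u"
  by (simp add: walk_def)

lemma walk_ends:
  assumes "walk T u xs v"
  shows "u \<in> set xs" "v \<in> set xs" "u \<in> rverts T" "v \<in> rverts T" "set xs \<subseteq> rverts T"
  using assms unfolding walk_def by (auto dest: hd_in_set last_in_set)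

lemma walk_append:
  assumes "walk T u xs v" "walk T v' ys w" "{v, v'} \<in> redges T"
  shows "walk T u (xs @ ys) w"
  using assms by (auto simp: walk_def successively_append_iff)

lemma walk_Cons:
  assumes "walk T v xs w" "u \<in> rverts T" "{u, v} \<in> redges T"
  shows "walk T u (u # xs) w"
  using walk_append[OF walk_single[OF assms(2)] assms(1,3)] by simp

lemma walk_snoc:
  assumes "walk T u xs v" "w \<in> rverts T" "{v, w} \<in> redges T"
  shows "walk T u (xs @ [w]) w"
  using walk_append[OF assms(1) walk_single[OF assms(2)] assms(3)] by simp

lemma walk_rev: "walk T u xs v \<Longrightarrow> walk T v (rev xs) u"
  by (auto simp: walk_def hd_rev last_rev insert_commute)

lemma walk_take:
  assumes "walk T u (xs @ y # ys) v"
  shows "walk T u (xs @ [y]) y"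
  using assms
  by (auto simp: walk_def successively_append_iff hd_append split: if_splits)

lemma walk_drop:
  assumes "walk T u (xs @ y # ys) v"
  shows "walk T y (y # ys) v"
  using assms by (auto simp: walk_def successively_append_iff)

lemma walk_join:
  assumes "walk T u xs v" "walk T v ys w"
  shows "\<exists>zs. walk T u zs w \<and> set zs \<subseteq> set xs \<union> set ys"
proof -
  obtain y ys' where ys: "ys = v # ys'"
    using assms(2) by (cases ys) (auto simp: walk_def)
  show ?thesis
  proof (cases ys')
    case Nil
    then show ?thesis using assms ys by (auto simp: walk_def)
  next
    case (Cons z zs)
    have "walk T u (xs @ ys') w"
      using assms ys Cons by (auto simp: walk_def successively_append_iff)
    then show ?thesis using ys by force
  qed
qed

lemma walk_mono:
  assumes "walk S u xs v" "rverts S \<subseteq> rverts T" "redges S \<subseteq> redges T"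
  shows "walk T u xs v"
  using assms unfolding walk_def by (auto elim: successively_mono)

lemma walk_restrict:
  assumes "walk T u xs v" "set xs \<subseteq> rverts S"
    and "\<And>e. e \<in> redges T \<Longrightarrow> e \<subseteq> rverts S \<Longrightarrow> e \<in> redges S"
  shows "walk S u xs v"
proof -
  have "successively (\<lambda>a b. {a, b} \<in> redges T) xs"
    using assms(1) by (simp add: walk_def)
  then have "successively (\<lambda>a b. {a, b} \<in> redges S) xs"
    by (rule successively_mono) (use assms(2,3) in auto)
  then show ?thesis using assms(1,2) by (simp add: walk_def)
qed

lemma walk_distinct:
  assumes "walk T u xs v"
  shows "\<exists>ys. walk T u ys v \<and> distinct ys \<and> set ys \<subseteq> set xs"
  using assms
proof (induction xs arbitrary: u)
  case Nil
  then show ?case by (simp add: walk_def)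
next
  case (Cons x xs)
  have x: "x = u" using Cons.prems by (simp add: walk_def)
  show ?case
  proof (cases xs)
    case Nil
    then show ?thesis using Cons.prems by (intro exI[of _ "[x]"]) auto
  next
    case (Cons y zs)
    have w: "walk T y xs v" and e: "{u, y} \<in> redges T" and u: "u \<in> rverts T"
      using Cons.prems Cons x by (auto simp: walk_def)
    obtain ys where ys: "walk T y ys v" "distinct ys" "set ys \<subseteq> set xs"
      using Cons.IH[OF w] by blast
    show ?thesis
    proof (cases "u \<in> set ys")
      case True
      then obtain as bs where ab: "ys = as @ u # bs" by (auto dest: split_list)
      then show ?thesis
        using ys walk_drop[of T y as u bs v] by (intro exI[of _ "u # bs"]) auto
    next
      case False
      then show ?thesis
        using ys walk_Cons[OF ys(1) u e] x by (intro exI[of _ "u # ys"]) auto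
    qed
  qed
qed

lemma distance_walk:
  assumes "walk T u xs v"
  obtains ys where "walk T u ys v" "length ys = Suc (distance T u v)"
proof -
  have "\<exists>ys. walk T u ys v \<and> length ys = Suc (length xs - 1)"
    using assms by (intro exI[of _ xs]) (auto simp: walk_def)
  then have "\<exists>ys. walk T u ys v \<and> length ys = Suc (distance T u v)"
    unfolding distance_def by (rule LeastI)
  then show ?thesis using that by blast
qed

lemma distance_le:
  assumes "walk T u xs v"
  shows "distance T u v < length xs"
proof -
  have "distance T u v \<le> length xs - 1"
    unfolding distance_def using assms by (intro Least_le) (auto simp: walk_def)
  then show ?thesis using assms by (cases xs) (auto simp: walk_def)
qed

lemma distance_commute: "distance T u v = distance T v u"
proof -
  have "(\<exists>xs. walk T u xs v \<and> length xs = Suc k) \<longleftrightarrow> (\<exists>xs. walk T v xs u \<and> length xs = Suc k)" for k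
    by (metis walk_rev length_rev)
  then show ?thesis by (simp add: distance_def)
qed

lemma distance_self: "u \<in> rverts T \<Longrightarrow> distance T u u = 0"
  using distance_le[OF walk_single] by fastforce

text \<open>A function that grows by at most one along each edge bounds lengths of walks from below. This
  yields lower bounds for distances without any surgery on walks: it suffices to guess the distance
  function and check it edge by edge.\<close>

lemma walk_potential:
  fixes f :: "'a \<Rightarrow> nat"
  assumes "walk T u xs v"
    and "\<And>a b. {a, b} \<in> redges T \<Longrightarrow> f b \<le> Suc (f a)"
  shows "f v < f u + length xs"
  using assms(1)
proof (induction xs arbitrary: u)
  case Nil
  then show ?case by (simp add: walk_def)
next
  case (Cons x xs)
  have x: "x = u" using Cons.prems by (simp add: walk_def)
  show ?case
  proof (cases xs)
    case Nil
    then show ?thesis using Cons.prems by (auto simp: walk_def)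
  next
    case (Cons y zs)
    have w: "walk T y xs v" and e: "{u, y} \<in> redges T"
      using Cons.prems Cons x by (auto simp: walk_def)
    show ?thesis using Cons.IH[OF w] assms(2)[OF e] by simp
  qed
qed

lemma distance_eqI:
  fixes f :: "'a \<Rightarrow> nat"
  assumes "walk T u xs v" "length xs = Suc (f v)" "f u = 0"
    and "\<And>a b. {a, b} \<in> redges T \<Longrightarrow> f b \<le> Suc (f a)"
  shows "distance T u v = f v"
proof -
  obtain ys where ys: "walk T u ys v" "length ys = Suc (distance T u v)"
    using distance_walk[OF assms(1)] .
  have "f v < f u + length ys"
    by (rule walk_potential[OF ys(1)]) (rule assms(4))
  then show ?thesis using distance_le[OF assms(1)] assms(2,3) ys(2) by simp
qed

lemma rooted_tree_edge:
  assumes "rooted_tree T" "{a, b} \<in> redges T"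
  shows "a \<in> rverts T" "b \<in> rverts T" "a \<noteq> b"
proof -
  have "{a, b} \<subseteq> rverts T" "card {a, b} = 2"
    using assms unfolding rooted_tree_def by blast+
  then show "a \<in> rverts T" "b \<in> rverts T" "a \<noteq> b" by auto
qed

lemma rooted_tree_edge_subset: "rooted_tree T \<Longrightarrow> e \<in> redges T \<Longrightarrow> e \<subseteq> rverts T \<and> e \<noteq> {}"
  unfolding rooted_tree_def by force

lemma rooted_tree_walk:
  assumes "rooted_tree T" "u \<in> rverts T" "v \<in> rverts T"
  obtains xs where "walk T u xs v"
  using assms unfolding rooted_tree_def by blast

lemma rooted_tree_root: "rooted_tree T \<Longrightarrow> rroot T \<in> rverts T"
  by (simp add: rooted_tree_def)

lemma rooted_tree_finite: "rooted_tree T \<Longrightarrow> finite (rverts T)"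
  by (simp add: rooted_tree_def)

lemma distance_edge:
  assumes "rooted_tree T" "u \<in> rverts T" "{a, b} \<in> redges T"
  shows "distance T u b \<le> Suc (distance T u a)"
proof -
  obtain xs0 where "walk T u xs0 a"
    using rooted_tree_walk[OF assms(1,2) rooted_tree_edge(1)[OF assms(1,3)]] .
  then obtain xs where xs: "walk T u xs a" "length xs = Suc (distance T u a)"
    using distance_walk by metis
  show ?thesis
    using distance_le[OF walk_snoc[OF xs(1) rooted_tree_edge(2)[OF assms(1,3)] assms(3)]] xs(2)
    by simp
qed

lemma rooted_tree_distance_walk:
  assumes "rooted_tree T" "u \<in> rverts T" "v \<in> rverts T"
  obtains xs where "walk T u xs v" "length xs = Suc (distance T u v)"
  using rooted_tree_walk[OF assms] distance_walk by metis

section \<open>Grafting one tree onto the root of another\<close>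

definition graft :: "'a rgraph \<Rightarrow> 'a rgraph \<Rightarrow> 'a rgraph" where
  "graft S T =
     \<lparr>rverts = rverts S \<union> rverts T,
      redges = insert {rroot S, rroot T} (redges S \<union> redges T),
      rroot = rroot S\<rparr>"

lemma graft_simps [simp]:
  "rverts (graft S T) = rverts S \<union> rverts T"
  "redges (graft S T) = insert {rroot S, rroot T} (redges S \<union> redges T)"
  "rroot (graft S T) = rroot S"
  by (simp_all add: graft_def)

text \<open>Walks and distances do not see which of the two roots is the root of the graft, so each fact
  about the left part transfers to the right part.\<close>

lemma walk_graft_commute: "walk (graft T S) = walk (graft S T)"
  by (intro ext) (simp add: walk_def insert_commute Un_commute)

lemma distance_graft_commute: "distance (graft T S) = distance (graft S T)"
  by (intro ext) (simp add: distance_def walk_graft_commute)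

lemma is_cycle_graft_commute: "is_cycle (graft T S) = is_cycle (graft S T)"
  by (intro ext) (simp add: is_cycle_def walk_graft_commute insert_commute Un_commute)

locale disjoint_trees =
  fixes S T :: "'a rgraph"
  assumes S: "rooted_tree S" and T: "rooted_tree T"
    and disj: "rverts S \<inter> rverts T = {}"
begin

lemma swap: "disjoint_trees T S"
  using S T disj by unfold_locales auto

lemma roots: "rroot S \<in> rverts S" "rroot T \<in> rverts T" "rroot S \<notin> rverts T" "rroot T \<notin> rverts S"
  using rooted_tree_root[OF S] rooted_tree_root[OF T] disj by auto

lemma walk_graft_left: "walk S u xs v \<Longrightarrow> walk (graft S T) u xs v"
  by (erule walk_mono) auto

lemma walk_graft_right: "walk T u xs v \<Longrightarrow> walk (graft S T) u xs v"
  by (erule walk_mono) auto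

lemma graft_edge_left: "e \<in> redges (graft S T) \<Longrightarrow> e \<subseteq> rverts S \<Longrightarrow> e \<in> redges S"
  using roots rooted_tree_edge_subset[OF T, of e] disj by auto

lemma walk_graft_restrict_left:
  "walk (graft S T) u xs v \<Longrightarrow> set xs \<subseteq> rverts S \<Longrightarrow> walk S u xs v"
  using walk_restrict graft_edge_left by metis

lemma crossing_edge:
  assumes "{a, b} \<in> redges (graft S T)" "a \<in> rverts S" "b \<in> rverts T"
  shows "a = rroot S \<and> b = rroot T"
proof -
  have "{a, b} \<notin> redges S" "{a, b} \<notin> redges T"
    using assms(2,3) disj rooted_tree_edge[OF S, of a b] rooted_tree_edge[OF T, of a b] by auto
  then have "{a, b} = {rroot S, rroot T}" using assms(1) by simp
  then show ?thesis using assms(2,3) roots disj by (auto simp: doubleton_eq_iff)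
qed

lemma crossing_walk:
  assumes "walk (graft S T) u xs v" "u \<in> rverts S" "v \<in> rverts T"
  shows "\<exists>ys zs. xs = ys @ rroot S # rroot T # zs"
  using assms(1,2)
proof (induction xs arbitrary: u)
  case Nil
  then show ?case by (simp add: walk_def)
next
  case (Cons x xs)
  have x: "x = u" using Cons.prems by (simp add: walk_def)
  show ?case
  proof (cases xs)
    case Nil
    then show ?thesis using Cons.prems assms(3) disj by (auto simp: walk_def)
  next
    case (Cons y zs)
    have w: "walk (graft S T) y xs v" and e: "{u, y} \<in> redges (graft S T)"
      using Cons.prems(1) Cons x by (auto simp: walk_def)
    show ?thesis
    proof (cases "y \<in> rverts S")
      case True
      then obtain as bs where "xs = as @ rroot S # rroot T # bs" using Cons.IH[OF w] by blast
      then show ?thesis by (metis append_Cons)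
    next
      case False
      then have "y \<in> rverts T" using walk_ends(3)[OF w] by simp
      then have "u = rroot S \<and> y = rroot T" using crossing_edge[OF e] Cons.prems by blast
      then show ?thesis using x Cons by (intro exI[of _ "[]"] exI[of _ zs]) simp
    qed
  qed
qed

lemma crossing_walk_root:
  assumes "walk (graft S T) u xs v" "u \<in> rverts S" "v \<in> rverts T"
  shows "rroot S \<in> set xs"
  using crossing_walk[OF assms] by auto

lemma graft_connected_left:
  assumes "u \<in> rverts S" "v \<in> rverts S \<union> rverts T"
  shows "\<exists>xs. walk (graft S T) u xs v"
proof (cases "v \<in> rverts S")
  case True
  then show ?thesis using rooted_tree_walk[OF S assms(1)] walk_graft_left by metis
next
  case False
  then have v: "v \<in> rverts T" using assms by simp
  obtain xs where "walk S u xs (rroot S)" using rooted_tree_walk[OF S assms(1) roots(1)] .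
  moreover obtain ys where "walk T (rroot T) ys v" using rooted_tree_walk[OF T roots(2) v] .
  ultimately show ?thesis
    using walk_append[OF walk_graft_left walk_graft_right] by fastforce
qed

text \<open>A cycle starting in \<open>S\<close> cannot stay there. If it ends in \<open>T\<close>, its closing edge is the
  grafting edge, and it crosses that edge once more inside, so it has only two vertices. If it
  visits \<open>T\<close> and returns, it passes through the root of \<open>S\<close> both before and after the visit.
  Exchanging the two trees, a cycle cannot start in \<open>T\<close> either.\<close>

lemma cycle_start_right:
  assumes "is_cycle (graft S T) xs"
  shows "hd xs \<in> rverts T"
proof (rule ccontr)
  assume nh: "hd xs \<notin> rverts T"
  have w: "walk (graft S T) (hd xs) xs (last xs)" and d: "distinct xs" and l: "3 \<le> length xs"
    and e: "{last xs, hd xs} \<in> redges (graft S T)"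
    using assms by (auto simp: is_cycle_def)
  have h: "hd xs \<in> rverts S" using nh walk_ends(3)[OF w] by simp
  show False
  proof (cases "last xs \<in> rverts T")
    case True
    obtain ys zs where yz: "xs = ys @ rroot S # rroot T # zs"
      using crossing_walk[OF w h True] by blast
    have "hd xs = rroot S" "last xs = rroot T"
      using crossing_edge[of "hd xs" "last xs"] e h True by (auto simp: insert_commute)
    then have "ys = []" "zs = []"
      using d yz by (cases ys; auto) (cases zs rule: rev_cases; use d yz \<open>last xs = rroot T\<close> in auto)
    then show False using l yz by simp
  next
    case False
    then have la: "last xs \<in> rverts S" using walk_ends(4)[OF w] by simp
    have "\<not> set xs \<subseteq> rverts S"
    proof
      assume "set xs \<subseteq> rverts S"
      then have "is_cycle S xs"
        using assms walk_graft_restrict_left[OF w] graft_edge_left[OF e] h la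
        by (auto simp: is_cycle_def)
      then show False using S by (auto simp: rooted_tree_def)
    qed
    then obtain y where y: "y \<in> set xs" "y \<in> rverts T"
      using walk_ends(5)[OF w] by auto
    then obtain ps qs where pq: "xs = ps @ y # qs" by (auto dest: split_list)
    have "rroot S \<in> set (ps @ [y])"
      using crossing_walk_root[OF walk_take[OF w[unfolded pq]]] h y(2) pq by force
    moreover have "walk (graft T S) y (y # qs) (last xs)"
      using walk_drop w pq walk_graft_commute by metis
    then have "rroot S \<in> set (y # qs)"
      using crossing_walk_root[OF walk_rev la y(2), of "y # qs"] by (simp add: walk_graft_commute)
    ultimately show False using d pq roots y(2) by auto
  qed
qed

lemma rooted_tree_graft: "rooted_tree (graft S T)"
proof -
  interpret swap: disjoint_trees T S by (rule swap)
  have "\<not> is_cycle (graft S T) xs" for xs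
    using cycle_start_right swap.cycle_start_right is_cycle_graft_commute disj by (metis disjoint_iff)
  moreover have "\<exists>xs. walk (graft S T) u xs v"
    if "u \<in> rverts (graft S T)" "v \<in> rverts (graft S T)" for u v
  proof (cases "u \<in> rverts S")
    case True
    then show ?thesis using graft_connected_left that by simp
  next
    case False
    then have "\<exists>xs. walk (graft T S) u xs v"
      using swap.graft_connected_left[of u v] that by auto
    then show ?thesis by (simp add: walk_graft_commute)
  qed
  moreover have "e \<subseteq> rverts (graft S T) \<and> card e = 2" if "e \<in> redges (graft S T)" for e
  proof -
    have "card {rroot S, rroot T} = 2"
      using roots by (metis card_2_iff)
    then show ?thesis using that S T roots unfolding rooted_tree_def by auto
  qed
  ultimately show ?thesis
    using roots rooted_tree_finite[OF S] rooted_tree_finite[OF T] by (simp add: rooted_tree_def)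
qed

text \<open>The potential is the expected distance from \<open>u\<close>: computed in \<open>S\<close>, or through the grafting
  edge for the vertices of \<open>T\<close>.\<close>

lemma distance_graft:
  assumes u: "u \<in> rverts S"
  shows "v \<in> rverts S \<Longrightarrow> distance (graft S T) u v = distance S u v"
    and "v \<in> rverts T \<Longrightarrow>
      distance (graft S T) u v = Suc (distance S u (rroot S) + distance T (rroot T) v)"
proof -
  define f where "f = (\<lambda>y. if y \<in> rverts S then distance S u y
    else Suc (distance S u (rroot S) + distance T (rroot T) y))"
  have f0: "f u = 0" using u distance_self by (simp add: f_def)
  have lip: "f b \<le> Suc (f a)" if e: "{a, b} \<in> redges (graft S T)" for a b
  proof -
    consider "{a, b} = {rroot S, rroot T}" | "{a, b} \<in> redges S" | "{a, b} \<in> redges T"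
      using e by auto
    then show ?thesis
    proof cases
      case 1
      then show ?thesis using roots distance_self[of "rroot T" T]
        by (auto simp: f_def doubleton_eq_iff)
    next
      case 2
      then show ?thesis
        using distance_edge[OF S u] rooted_tree_edge[OF S] by (simp add: f_def)
    next
      case 3
      have "a \<notin> rverts S" "b \<notin> rverts S"
        using rooted_tree_edge[OF T 3] disj by auto
      then show ?thesis
        using distance_edge[OF T roots(2) 3] by (simp add: f_def)
    qed
  qed
  show "distance (graft S T) u v = distance S u v" if v: "v \<in> rverts S"
  proof -
    obtain xs where xs: "walk S u xs v" "length xs = Suc (distance S u v)"
      using rooted_tree_distance_walk[OF S u v] .
    have "distance (graft S T) u v = f v"
      by (rule distance_eqI[where f = f, OF walk_graft_left[OF xs(1)] _ f0 lip]) (use xs v in \<open>auto simp: f_def\<close>)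
    then show ?thesis using v by (simp add: f_def)
  qed
  show "distance (graft S T) u v = Suc (distance S u (rroot S) + distance T (rroot T) v)"
    if v: "v \<in> rverts T"
  proof -
    have nv: "v \<notin> rverts S" using v disj by auto
    obtain xs where xs: "walk S u xs (rroot S)" "length xs = Suc (distance S u (rroot S))"
      using rooted_tree_distance_walk[OF S u roots(1)] .
    obtain ys where ys: "walk T (rroot T) ys v" "length ys = Suc (distance T (rroot T) v)"
      using rooted_tree_distance_walk[OF T roots(2) v] .
    have "walk (graft S T) u (xs @ ys) v"
      using walk_append[OF walk_graft_left[OF xs(1)] walk_graft_right[OF ys(1)]] by simp
    then have "distance (graft S T) u v = f v"
      by (rule distance_eqI[where f = f, OF _ _ f0 lip]) (use xs ys nv in \<open>auto simp: f_def\<close>)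
    then show ?thesis using nv by (simp add: f_def)
  qed
qed

lemma distance_graft_right:
  assumes "u \<in> rverts T" "v \<in> rverts T"
  shows "distance (graft S T) u v = distance T u v"
proof -
  interpret swap: disjoint_trees T S by (rule swap)
  show ?thesis using swap.distance_graft(1) assms distance_graft_commute by metis
qed

lemma root_neighbours_graft:
  "root_neighbours (graft S T) = insert (rroot T) (root_neighbours S)"
  using crossing_edge[of "rroot S"] roots graft_edge_left[of "{rroot S, _}"]
  by (auto simp: root_neighbours_def)

lemma subtree_at_graft_right: "subtree_at (graft S T) (rroot T) = T"
proof -
  interpret swap: disjoint_trees T S by (rule swap)
  let ?W = "{w. \<exists>xs. walk (graft S T) (rroot T) xs w \<and> rroot S \<notin> set xs}"
  have W: "?W = rverts T"
  proof (intro equalityI subsetI)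
    fix w assume "w \<in> ?W"
    then obtain xs where xs: "walk (graft S T) (rroot T) xs w" "rroot S \<notin> set xs" by blast
    show "w \<in> rverts T"
    proof (rule ccontr)
      assume "w \<notin> rverts T"
      then have "w \<in> rverts S" using walk_ends(4)[OF xs(1)] by simp
      then obtain ys zs where "xs = ys @ rroot T # rroot S # zs"
        using swap.crossing_walk[of "rroot T" xs w] xs roots walk_graft_commute by metis
      then show False using xs by simp
    qed
  next
    fix w assume "w \<in> rverts T"
    then obtain xs where xs: "walk T (rroot T) xs w" using rooted_tree_walk[OF T roots(2)] by blast
    then show "w \<in> ?W"
      using walk_graft_right[OF xs] walk_ends(5)[OF xs] roots by blast
  qed
  have "{e \<in> redges (graft S T). e \<subseteq> rverts T} = redges T"
    using swap.graft_edge_left rooted_tree_edge_subset[OF T] by (auto simp: insert_commute)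
  then show ?thesis by (simp add: subtree_at_def W)
qed

lemma subtree_at_graft_left:
  assumes "v \<in> root_neighbours S"
  shows "subtree_at (graft S T) v = subtree_at S v"
proof -
  let ?W = "{w. \<exists>xs. walk (graft S T) v xs w \<and> rroot S \<notin> set xs}"
  let ?W' = "{w. \<exists>xs. walk S v xs w \<and> rroot S \<notin> set xs}"
  have v: "v \<in> rverts S" using assms by (simp add: root_neighbours_def)
  have W: "?W = ?W'"
  proof (intro equalityI subsetI)
    fix w assume "w \<in> ?W"
    then obtain xs where xs: "walk (graft S T) v xs w" "rroot S \<notin> set xs" by blast
    have "y \<in> rverts S" if "y \<in> set xs" for y
    proof (rule ccontr)
      assume "y \<notin> rverts S"
      then have y: "y \<in> rverts T" using walk_ends(5)[OF xs(1)] that by auto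
      obtain ps qs where pq: "xs = ps @ y # qs" using \<open>y \<in> set xs\<close> by (auto dest: split_list)
      have "rroot S \<in> set (ps @ [y])"
        using crossing_walk_root[OF walk_take[OF xs(1)[unfolded pq]] v y] .
      then show False using xs(2) pq by auto
    qed
    then show "w \<in> ?W'" using walk_graft_restrict_left[OF xs(1)] xs(2) by blast
  next
    fix w assume "w \<in> ?W'"
    then show "w \<in> ?W" using walk_graft_left by blast
  qed
  have sub: "?W' \<subseteq> rverts S" using walk_ends(4) by fast
  have "redges S \<subseteq> redges (graft S T)" by auto
  then have "{e \<in> redges (graft S T). e \<subseteq> X} = {e \<in> redges S. e \<subseteq> X}" if "X \<subseteq> rverts S" for X
    using that graft_edge_left by blast
  from this[OF sub]
  show ?thesis by (simp add: subtree_at_def W del: graft_simps(2))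
qed

end

section \<open>Matula numbers\<close>

lemma prime_nth_prime: "prime (nth_prime m)"
  using enumerate_in_set[OF primes_infinite] by (simp add: nth_prime_def)

lemma nth_prime_inj:
  assumes "nth_prime s = nth_prime t" "1 \<le> s" "1 \<le> t"
  shows "s = t"
proof -
  have "s - 1 = t - 1"
    using assms(1) inj_enumerate[OF primes_infinite] by (simp add: nth_prime_def inj_eq)
  then show ?thesis using assms by simp
qed

lemma prime_is_nth_prime:
  assumes "prime (p :: nat)"
  obtains t where "1 \<le> t" "p = nth_prime t"
proof -
  obtain k where "enumerate {p::nat. prime p} k = p"
    using enumerate_Ex[OF primes_infinite] assms by blast
  then show ?thesis using that[of "Suc k"] by (simp add: nth_prime_def)
qed

lemma less_nth_prime: "t < nth_prime t"
proof -
  have "k + 1 < enumerate {p::nat. prime p} k" for k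
  proof (induction k)
    case 0
    have "prime (enumerate {p::nat. prime p} 0)"
      using enumerate_in_set[OF primes_infinite, of 0] by simp
    then show ?case using prime_gt_1_nat by simp
  next
    case (Suc k)
    then show ?case using enumerate_step[OF primes_infinite, of k] by linarith
  qed
  from this[of "t - 1"] show ?thesis by (simp add: nth_prime_def)
qed

lemma finite_root_neighbours: "rooted_tree T \<Longrightarrow> finite (root_neighbours T)"
  by (simp add: root_neighbours_def rooted_tree_finite)

text \<open>For the one-vertex tree the product is empty, in agreement with the value \<open>1\<close>.\<close>

lemma matula_prod:
  assumes "rooted_tree T"
  shows "matula T = (\<Prod>v\<in>root_neighbours T. nth_prime (matula (subtree_at T v)))"
proof (cases "rverts T = {rroot T}")
  case True
  then have "root_neighbours T = {}"
    using rooted_tree_edge(3)[OF assms, of "rroot T" "rroot T"] by (auto simp: root_neighbours_def)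
  then show ?thesis using assms True by (simp add: matula.simps)
next
  case False
  then show ?thesis using assms by (subst matula.simps) simp
qed

lemma matula_pos: "rooted_tree T \<Longrightarrow> 1 \<le> matula T"
  using prime_gt_0_nat[OF prime_nth_prime] by (auto simp: matula_prod Suc_le_eq intro!: prod_pos)

lemma rooted_tree_root_neighbour:
  assumes "rooted_tree T" "rverts T \<noteq> {rroot T}"
  shows "root_neighbours T \<noteq> {}"
proof -
  obtain u where u: "u \<in> rverts T" "u \<noteq> rroot T"
    using assms rooted_tree_root[OF assms(1)] by auto
  obtain xs where xs: "walk T (rroot T) xs u"
    using rooted_tree_walk[OF assms(1) rooted_tree_root[OF assms(1)] u(1)] .
  (* the case rule only serves to split xs into [], [x] and x # y # ys *)
  then obtain y ys where "xs = rroot T # y # ys"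
    using u by (cases xs rule: remdups_adj.cases) (auto simp: walk_def)
  then have "y \<in> root_neighbours T" using xs by (simp add: walk_def root_neighbours_def)
  then show ?thesis by blast
qed

lemma (in disjoint_trees) matula_graft: "matula (graft S T) = matula S * nth_prime (matula T)"
proof -
  have "rroot T \<notin> root_neighbours S" using roots by (simp add: root_neighbours_def)
  then show ?thesis
    by (simp add: matula_prod[OF rooted_tree_graft] matula_prod[OF S] root_neighbours_graft
        finite_root_neighbours[OF S] subtree_at_graft_right subtree_at_graft_left)
qed

lemma rooted_tree_subgraph:
  assumes "rooted_tree T" "V \<subseteq> rverts T" "r \<in> V"
    and conn: "\<And>u. u \<in> V \<Longrightarrow> \<exists>xs. walk T r xs u \<and> set xs \<subseteq> V"
  shows "rooted_tree \<lparr>rverts = V, redges = {e \<in> redges T. e \<subseteq> V}, rroot = r\<rparr>" (is "rooted_tree ?S")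
proof -
  have "\<not> is_cycle ?S xs" for xs
  proof
    assume c: "is_cycle ?S xs"
    then have "walk T (hd xs) xs (last xs)"
      using walk_mono[of ?S _ _ _ T] assms(2) by (force simp: is_cycle_def)
    then have "is_cycle T xs" using c by (simp add: is_cycle_def)
    then show False using assms(1) by (auto simp: rooted_tree_def)
  qed
  moreover have "\<exists>xs. walk ?S u xs v" if "u \<in> V" "v \<in> V" for u v
  proof -
    obtain xs where xs: "walk T r xs u" "set xs \<subseteq> V" using conn \<open>u \<in> V\<close> by blast
    obtain ys where ys: "walk T r ys v" "set ys \<subseteq> V" using conn \<open>v \<in> V\<close> by blast
    obtain zs where zs: "walk T u zs v" "set zs \<subseteq> V"
      using walk_join[OF walk_rev[OF xs(1)] ys(1)] xs(2) ys(2) by auto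
    have "walk ?S u zs v" by (rule walk_restrict[OF zs(1)]) (use zs in auto)
    then show ?thesis by blast
  qed
  ultimately show ?thesis
    using assms(1-3) finite_subset unfolding rooted_tree_def by auto
qed

text \<open>The subtree \<open>W\<close> at \<open>v\<close> is closed under steps that avoid the root, so an edge leaving \<open>W\<close>
  ends in the root; it must start in \<open>v\<close>, since otherwise it would close a cycle through the root
  and \<open>v\<close>. Thus a single edge connects \<open>W\<close> with the remaining vertices. These are
  connected to the root outside \<open>W\<close>, because a path without repetitions that starts at the root and
  enters \<open>W\<close> could leave it again only through the root.\<close>

lemma rooted_tree_as_graft:
  assumes T: "rooted_tree T" and v: "v \<in> root_neighbours T"
  obtains S where "disjoint_trees S (subtree_at T v)" "T = graft S (subtree_at T v)"
proof -
  define r where "r = rroot T"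
  define W where "W = {w. \<exists>xs. walk T v xs w \<and> r \<notin> set xs}"
  have sub: "subtree_at T v = \<lparr>rverts = W, redges = {e \<in> redges T. e \<subseteq> W}, rroot = v\<rparr>"
    by (simp add: subtree_at_def W_def r_def Let_def)
  define S where "S = \<lparr>rverts = rverts T - W, redges = {e \<in> redges T. e \<subseteq> rverts T - W}, rroot = r\<rparr>"
  have vT: "v \<in> rverts T" and rv: "{r, v} \<in> redges T"
    using v by (simp_all add: root_neighbours_def r_def)
  have vr: "v \<noteq> r" using rooted_tree_edge(3)[OF T rv] by simp
  have WT: "W \<subseteq> rverts T" using walk_ends(4) by (fastforce simp: W_def)
  have rW: "r \<notin> W" using walk_ends(2) by (fastforce simp: W_def)
  have vW: "v \<in> W" using walk_single[OF vT] vr by (force simp: W_def)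
  have step: "b \<in> W" if ab: "a \<in> W" "{a, b} \<in> redges T" "b \<noteq> r" for a b
  proof -
    obtain xs where "walk T v xs a" "r \<notin> set xs" using ab by (auto simp: W_def)
    then have "walk T v (xs @ [b]) b \<and> r \<notin> set (xs @ [b])"
      using walk_snoc[of T v xs a b] ab rooted_tree_edge(2)[OF T ab(2)] by auto
    then show ?thesis unfolding W_def by blast
  qed
  have along: "w \<in> W" if xs: "walk T a xs w" and a: "a \<in> W" and r: "r \<notin> set xs" for a xs w
  proof -
    obtain ys where ys: "walk T v ys a" "r \<notin> set ys" using a by (auto simp: W_def)
    obtain zs where "walk T v zs w" "set zs \<subseteq> set ys \<union> set xs"
      using walk_join[OF ys(1) xs] by auto
    then show ?thesis using ys r unfolding W_def by blast
  qed
  have wv: "w = v" if w: "w \<in> W" "{w, r} \<in> redges T" for w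
  proof (rule ccontr)
    assume "w \<noteq> v"
    obtain xs0 where "walk T v xs0 w" "r \<notin> set xs0" using w by (auto simp: W_def)
    then obtain xs where xs: "walk T v xs w" "distinct xs" "r \<notin> set xs"
      using walk_distinct[of T v xs0 w] by blast
    have "2 \<le> length xs"
      using xs(1) \<open>w \<noteq> v\<close> by (cases xs rule: remdups_adj.cases) (auto simp: walk_def)
    moreover have "walk T r (r # xs) w"
      using walk_Cons[OF xs(1) _ rv] rooted_tree_root[OF T] by (simp add: r_def)
    ultimately have "is_cycle T (r # xs)"
      using xs w by (auto simp: is_cycle_def walk_def)
    then show False using T by (auto simp: rooted_tree_def)
  qed
  have tree2: "rooted_tree (subtree_at T v)"
    unfolding sub
  proof (rule rooted_tree_subgraph[OF T WT vW])
    fix u assume "u \<in> W"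
    then obtain xs where xs: "walk T v xs u" "r \<notin> set xs" by (auto simp: W_def)
    have "y \<in> W" if y: "y \<in> set xs" for y
    proof -
      obtain ps qs where pq: "xs = ps @ y # qs" using y by (auto dest: split_list)
      have "walk T v (ps @ [y]) y" using walk_take xs(1) pq by metis
      moreover have "r \<notin> set (ps @ [y])" using xs(2) pq by auto
      ultimately show ?thesis unfolding W_def by blast
    qed
    then show "\<exists>xs. walk T v xs u \<and> set xs \<subseteq> W" using xs by blast
  qed
  have treeS: "rooted_tree S"
    unfolding S_def
  proof (rule rooted_tree_subgraph[OF T])
    show "rverts T - W \<subseteq> rverts T" by blast
    show "r \<in> rverts T - W" using rW rooted_tree_root[OF T] by (simp add: r_def)
    fix u assume u: "u \<in> rverts T - W"
    obtain xs0 where "walk T r xs0 u"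
      using rooted_tree_walk[OF T rooted_tree_root[OF T]] u unfolding r_def by blast
    then obtain xs where xs: "walk T r xs u" "distinct xs" using walk_distinct by metis
    have "y \<notin> W" if y: "y \<in> set xs" for y
    proof
      assume yW: "y \<in> W"
      obtain ps qs where pq: "xs = ps @ y # qs" using y by (auto dest: split_list)
      have "ps \<noteq> []" using xs(1) pq yW rW by (auto simp: walk_def)
      then have "r \<in> set ps" using xs(1) pq by (auto simp: walk_def)
      then have "r \<notin> set (y # qs)" using xs(2) pq by auto
      then have "u \<in> W" using along[OF walk_drop[OF xs(1)[unfolded pq]] yW] by blast
      then show False using u by blast
    qed
    then show "\<exists>xs. walk T r xs u \<and> set xs \<subseteq> rverts T - W"
      using xs walk_ends(5)[OF xs(1)] by blast
  qed
  have "disjoint_trees S (subtree_at T v)"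
    using treeS tree2 by unfold_locales (auto simp: S_def sub)
  moreover have "T = graft S (subtree_at T v)"
  proof (rule rgraph.equality)
    show "rverts T = rverts (graft S (subtree_at T v))" using WT by (auto simp: S_def sub)
    show "rroot T = rroot (graft S (subtree_at T v))" by (simp add: S_def r_def)
    have "e = {r, v} \<or> e \<subseteq> W \<or> e \<subseteq> rverts T - W" if e: "e \<in> redges T" for e
    proof -
      obtain a b where ab: "e = {a, b}"
        using e T unfolding rooted_tree_def by (metis card_2_iff)
      have verts: "a \<in> rverts T" "b \<in> rverts T" and edge: "{a, b} \<in> redges T" "{b, a} \<in> redges T"
        using rooted_tree_edge[OF T] e ab by (auto simp: insert_commute)
      have cross: "x = v \<and> y = r" if "x \<in> W" "y \<notin> W" "{x, y} \<in> redges T" for x y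
        using step[of x y] wv[of x] that by blast
      show ?thesis
        using cross[of a b] cross[of b a] verts edge ab by (cases "a \<in> W"; cases "b \<in> W") auto
    qed
    then show "redges T = redges (graft S (subtree_at T v))"
      using rv by (auto simp: S_def sub)
  qed simp
  ultimately show ?thesis using that by blast
qed

text \<open>The lower bound \<open>k\<close> on the vertices strengthens the induction: the tree to be grafted on can be
  placed above all vertices of the other one, which makes the two disjoint without renaming.\<close>

lemma ex_tree_matula:
  assumes "1 \<le> n"
  shows "\<exists>T :: nat rgraph. rooted_tree T \<and> matula T = n \<and> (\<forall>v\<in>rverts T. k \<le> v)"
  using assms
proof (induction n arbitrary: k rule: less_induct)
  case (less n)
  show ?case
  proof (cases "n = 1")
    case True
    let ?T = "\<lparr>rverts = {k}, redges = {}, rroot = k\<rparr>"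
    have "\<not> is_cycle ?T xs" for xs by (simp add: is_cycle_def)
    then have "rooted_tree ?T"
      using walk_single[of k ?T] by (auto simp: rooted_tree_def)
    then show ?thesis using True by (intro exI[of _ ?T]) (simp add: matula.simps)
  next
    case False
    then obtain p where p: "prime p" "p dvd n" using prime_factor_nat by blast
    then obtain t where t: "1 \<le> t" "p = nth_prime t" using prime_is_nth_prime by blast
    obtain m where m: "n = m * p" using p(2) by (metis dvd_def mult.commute)
    have m1: "1 \<le> m" using m less.prems by (cases m) auto
    have "m < n" using m m1 prime_gt_1_nat[OF p(1)] by simp
    then obtain S :: "nat rgraph" where S_props: "rooted_tree S" "matula S = m" "\<forall>v\<in>rverts S. k \<le> v"
      using less.IH m1 by blast
    have "t < n" using less_nth_prime[of t] t dvd_imp_le[OF p(2)] less.prems by simp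
    then obtain T :: "nat rgraph" where T_props: "rooted_tree T" "matula T = t"
        "\<forall>v\<in>rverts T. Suc (k + Max (rverts S)) \<le> v"
      using less.IH t(1) by blast
    have "rverts S \<inter> rverts T = {}"
      using T_props(3) Max_ge[OF rooted_tree_finite[OF S_props(1)]] by fastforce
    then interpret disjoint_trees S T using S_props T_props by unfold_locales
    have "\<forall>v\<in>rverts (graft S T). k \<le> v" using S_props(3) T_props(3) by fastforce
    then show ?thesis
      using rooted_tree_graft matula_graft S_props(2) T_props(2) m t(2) by blast
  qed
qed

lemma tree_of:
  assumes "1 \<le> n"
  shows "rooted_tree (tree_of n)" "matula (tree_of n) = n"
proof -
  have "\<exists>T :: nat rgraph. rooted_tree T \<and> matula T = n" using ex_tree_matula[OF assms] by blast
  then have "rooted_tree (tree_of n) \<and> matula (tree_of n) = n"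
    unfolding tree_of_def by (rule someI_ex)
  then show "rooted_tree (tree_of n)" "matula (tree_of n) = n" by blast+
qed

section \<open>Wiener polynomials\<close>

abbreviation root_poly :: "'a rgraph \<Rightarrow> int poly" where
  "root_poly T \<equiv> partial_wiener_poly T (rroot T)"

text \<open>The summand \<open>1\<close> accounts for the root itself.\<close>

lemma one_plus_root_poly:
  assumes "rooted_tree T"
  shows "1 + root_poly T = (\<Sum>i\<in>rverts T. monom 1 (distance T i (rroot T)))"
  using sum.remove[OF rooted_tree_finite[OF assms] rooted_tree_root[OF assms],
      of "\<lambda>i. monom 1 (distance T i (rroot T)) :: int poly"]
    distance_self[OF rooted_tree_root[OF assms]]
  by (simp add: partial_wiener_poly_def)

text \<open>An unordered pair with one element in each set is represented by the ordered pair that lists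
  the smaller element first; symmetry of \<open>f\<close> allows listing the element of \<open>A\<close> first instead.\<close>

lemma sum_unordered_pairs_Un:
  fixes f :: "'a::linorder \<Rightarrow> 'a \<Rightarrow> 'b::comm_monoid_add"
  assumes "finite A" "finite B" "A \<inter> B = {}" and sym: "\<And>i j. f i j = f j i"
  defines "pairs \<equiv> \<lambda>V. {(i, j). i \<in> V \<and> j \<in> V \<and> i < j}"
  shows "(\<Sum>(i, j)\<in>pairs (A \<union> B). f i j) =
    (\<Sum>(i, j)\<in>pairs A. f i j) + (\<Sum>(i, j)\<in>pairs B. f i j) + (\<Sum>i\<in>A. \<Sum>j\<in>B. f i j)"
proof -
  define C where "C = {(i, j). i < j \<and> (i \<in> A \<and> j \<in> B \<or> i \<in> B \<and> j \<in> A)}"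
  have fin: "finite (pairs V)" if "finite V" for V
    by (rule finite_subset[of _ "V \<times> V"]) (use that in \<open>auto simp: pairs_def\<close>)
  have finC: "finite C"
    by (rule finite_subset[of _ "(A \<union> B) \<times> (A \<union> B)"]) (use assms in \<open>auto simp: C_def\<close>)
  have eq: "pairs (A \<union> B) = (pairs A \<union> pairs B) \<union> C"
    by (auto simp: pairs_def C_def)
  have "(\<Sum>(i, j)\<in>C. f i j) = (\<Sum>(i, j)\<in>A \<times> B. f i j)"
    by (rule sum.reindex_bij_witness[where
          i = "\<lambda>(i, j). if i < j then (i, j) else (j, i)" and
          j = "\<lambda>(i, j). if i \<in> A then (i, j) else (j, i)"])
      (use assms(3) sym in \<open>auto simp: C_def neq_iff split: if_splits\<close>)
  moreover have "(\<Sum>(i, j)\<in>pairs (A \<union> B). f i j) =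
      (\<Sum>(i, j)\<in>pairs A. f i j) + (\<Sum>(i, j)\<in>pairs B. f i j) + (\<Sum>(i, j)\<in>C. f i j)"
    unfolding eq using fin[OF assms(1)] fin[OF assms(2)] finC assms(3)
    by (subst sum.union_disjoint; (subst sum.union_disjoint)?) (auto simp: pairs_def C_def)
  ultimately show ?thesis by (simp add: sum.cartesian_product)
qed

lemma (in disjoint_trees) root_poly_graft:
  "root_poly (graft S T) = root_poly S + monom 1 1 * (1 + root_poly T)"
proof -
  have 1: "monom 1 (distance (graft S T) i (rroot S)) = (monom 1 (distance S i (rroot S)) :: int poly)"
    if "i \<in> rverts S" for i
    using distance_graft(1)[OF that roots(1)] by simp
  have 2: "monom 1 (distance (graft S T) i (rroot S)) =
      monom 1 1 * (monom 1 (distance T i (rroot T)) :: int poly)" if "i \<in> rverts T" for i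
    using distance_graft(2)[OF roots(1) that] distance_self[OF roots(1)]
    by (simp add: distance_commute[of _ i] mult_monom)
  have "1 + root_poly (graft S T) =
      (\<Sum>i\<in>rverts S \<union> rverts T. monom 1 (distance (graft S T) i (rroot S)))"
    using one_plus_root_poly[OF rooted_tree_graft] by simp
  also have "\<dots> = (1 + root_poly S) + monom 1 1 * (1 + root_poly T)"
    unfolding one_plus_root_poly[OF S] one_plus_root_poly[OF T]
    using rooted_tree_finite[OF S] rooted_tree_finite[OF T] disj 1 2
    by (simp add: sum.union_disjoint sum_distrib_left)
  finally show ?thesis by simp
qed

lemma wiener_poly_graft:
  fixes S T :: "'a::linorder rgraph"
  assumes "disjoint_trees S T"
  shows "wiener_poly (graft S T) =
    wiener_poly S + wiener_poly T + monom 1 1 * (1 + root_poly S) * (1 + root_poly T)"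
proof -
  interpret disjoint_trees S T by (rule assms)
  have cross: "(\<Sum>i\<in>rverts S. \<Sum>j\<in>rverts T. monom 1 (distance (graft S T) i j)) =
      monom 1 1 * (1 + root_poly S) * (1 + root_poly T)"
  proof -
    have "monom 1 (distance (graft S T) i j) = monom 1 1 * (monom 1 (distance S i (rroot S)) *
        (monom 1 (distance T j (rroot T)) :: int poly))" if "i \<in> rverts S" "j \<in> rverts T" for i j
      using distance_graft(2)[OF that]
      by (simp add: distance_commute[of T "rroot T"] mult_monom)
    moreover have "monom 1 1 * (1 + root_poly S) * (1 + root_poly T) =
        (\<Sum>i\<in>rverts S. \<Sum>j\<in>rverts T. monom 1 1 * (monom 1 (distance S i (rroot S)) *
          monom 1 (distance T j (rroot T))))"
      unfolding one_plus_root_poly[OF S] one_plus_root_poly[OF T] mult.assoc sum_product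
      by (simp only: sum_distrib_left)
    ultimately show ?thesis by simp
  qed
  have left: "(\<Sum>(i, j)\<in>{(i, j). i \<in> rverts S \<and> j \<in> rverts S \<and> i < j}.
      monom 1 (distance (graft S T) i j)) = wiener_poly S"
    unfolding wiener_poly_def by (intro sum.cong) (auto simp: distance_graft(1))
  have right: "(\<Sum>(i, j)\<in>{(i, j). i \<in> rverts T \<and> j \<in> rverts T \<and> i < j}.
      monom 1 (distance (graft S T) i j)) = wiener_poly T"
    unfolding wiener_poly_def by (intro sum.cong) (auto simp: distance_graft_right)
  show ?thesis
    unfolding left[symmetric] right[symmetric] cross[symmetric]
    unfolding wiener_poly_def graft_simps(1)
    by (rule sum_unordered_pairs_Un)
      (simp_all add: rooted_tree_finite[OF S] rooted_tree_finite[OF T] disj distance_commute)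
qed

lemma matula_eq_1_singleton:
  assumes "rooted_tree T" "matula T = 1"
  shows "rverts T = {rroot T}"
proof (rule ccontr)
  assume "rverts T \<noteq> {rroot T}"
  then obtain v where v: "v \<in> root_neighbours T" using rooted_tree_root_neighbour[OF assms(1)] by blast
  then have "nth_prime (matula (subtree_at T v)) dvd matula T"
    unfolding matula_prod[OF assms(1)] using finite_root_neighbours[OF assms(1)] by (rule dvd_prodI[rotated])
  then show False using assms(2) prime_nth_prime not_prime_unit by metis
qed

lemma polys_singleton:
  assumes "rverts T = {rroot T}"
  shows "root_poly T = 0" "wiener_poly T = 0"
proof -
  have empty: "{(i, j). i \<in> rverts T \<and> j \<in> rverts T \<and> i < j} = {}" using assms by auto
  show "wiener_poly T = 0" unfolding wiener_poly_def empty by simp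
qed (simp add: partial_wiener_poly_def assms)

lemma graft_of_prime_factor:
  assumes "rooted_tree U" "matula U = m * nth_prime t" "1 \<le> t"
  obtains S T where "disjoint_trees S T" "U = graft S T" "matula S = m" "matula T = t"
proof -
  have "nth_prime t dvd (\<Prod>v\<in>root_neighbours U. nth_prime (matula (subtree_at U v)))"
    using assms(2) matula_prod[OF assms(1)] by (metis dvd_triv_right)
  then obtain v where v: "v \<in> root_neighbours U" "nth_prime t dvd nth_prime (matula (subtree_at U v))"
    by (auto simp: prime_dvd_prod_iff finite_root_neighbours[OF assms(1)] prime_nth_prime)
  obtain S where graft: "disjoint_trees S (subtree_at U v)" "U = graft S (subtree_at U v)"
    using rooted_tree_as_graft[OF assms(1) v(1)] .
  interpret disjoint_trees S "subtree_at U v" by (rule graft(1))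
  have "nth_prime t = nth_prime (matula (subtree_at U v))"
    using v(2) prime_nth_prime primes_dvd_imp_eq by blast
  then have t: "matula (subtree_at U v) = t" using nth_prime_inj matula_pos[OF T] assms(3) by metis
  have "matula S * nth_prime t = m * nth_prime t" using matula_graft graft(2) t assms(2) by metis
  then have "matula S = m" using prime_gt_0_nat[OF prime_nth_prime[of t]] by simp
  then show ?thesis using that graft t by blast
qed

text \<open>Split the same prime factor off both trees; the two parts have smaller Matula numbers, which
  agree for the two trees, because \<open>t < p\<^sub>t\<close>.\<close>

lemma matula_determines_polys:
  fixes U V :: "'a::linorder rgraph"
  assumes "rooted_tree U" "rooted_tree V" "matula U = matula V"
  shows "root_poly U = root_poly V \<and> wiener_poly U = wiener_poly V"
  using assms
proof (induction "matula U" arbitrary: U V rule: less_induct)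
  case less
  show ?case
  proof (cases "matula U = 1")
    case True
    then show ?thesis using less.prems matula_eq_1_singleton polys_singleton by metis
  next
    case False
    then obtain p where p: "prime p" "p dvd matula U" using prime_factor_nat by blast
    then obtain t where t: "1 \<le> t" "p = nth_prime t" using prime_is_nth_prime by blast
    obtain m where m: "matula U = m * nth_prime t" using p(2) t(2) by (metis dvd_def mult.commute)
    obtain S T where ST: "disjoint_trees S T" "U = graft S T" "matula S = m" "matula T = t"
      using graft_of_prime_factor[OF less.prems(1) m t(1)] .
    obtain S' T' where ST': "disjoint_trees S' T'" "V = graft S' T'" "matula S' = m" "matula T' = t"
      using graft_of_prime_factor[OF less.prems(2) _ t(1)] m less.prems(3) by metis
    interpret A: disjoint_trees S T by (rule ST(1))
    interpret B: disjoint_trees S' T' by (rule ST'(1))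
    have "m < matula U"
      using m prime_gt_1_nat[OF prime_nth_prime[of t]] matula_pos[OF A.S] ST(3) by simp
    then have 1: "root_poly S = root_poly S' \<and> wiener_poly S = wiener_poly S'"
      using less.hyps[OF _ A.S B.S] ST ST' by simp
    have "t < matula U"
      using less_nth_prime[of t] t dvd_imp_le[OF p(2)] matula_pos[OF less.prems(1)] by simp
    then have 2: "root_poly T = root_poly T' \<and> wiener_poly T = wiener_poly T'"
      using less.hyps[OF _ A.T B.T] ST ST' by simp
    show ?thesis
      using 1 2 by (simp add: ST(2) ST'(2) A.root_poly_graft B.root_poly_graft
          wiener_poly_graft[OF ST(1)] wiener_poly_graft[OF ST'(1)] del: graft_simps)
  qed
qed

lemma polys_of_matula:
  fixes T :: "nat rgraph"
  assumes "rooted_tree T"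
  shows "root_poly T = PWP (matula T)" "wiener_poly T = WP (matula T)"
  using matula_determines_polys[OF assms tree_of(1)] tree_of(2) matula_pos[OF assms]
  by (simp_all add: PWP_def WP_def)

lemma polys_one: "PWP 1 = 0" "WP 1 = 0"
  using polys_singleton[OF matula_eq_1_singleton[OF tree_of[of 1]]] by (simp_all add: PWP_def WP_def)

lemma polys_mult_nth_prime:
  assumes "1 \<le> m" "1 \<le> t"
  shows "PWP (m * nth_prime t) = PWP m + monom 1 1 * (1 + PWP t)"
    and "WP (m * nth_prime t) = WP m + WP t + monom 1 1 * (1 + PWP m) * (1 + PWP t)"
proof -
  obtain S :: "nat rgraph" where S_props: "rooted_tree S" "matula S = m"
    using ex_tree_matula[OF assms(1)] by blast
  obtain T :: "nat rgraph" where T_props: "rooted_tree T" "matula T = t"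
      "\<forall>v\<in>rverts T. Suc (Max (rverts S)) \<le> v"
    using ex_tree_matula[OF assms(2)] by blast
  have "rverts S \<inter> rverts T = {}"
    using T_props(3) Max_ge[OF rooted_tree_finite[OF S_props(1)]] by fastforce
  then interpret disjoint_trees S T using S_props T_props by unfold_locales
  show "PWP (m * nth_prime t) = PWP m + monom 1 1 * (1 + PWP t)"
    using root_poly_graft polys_of_matula(1)[OF rooted_tree_graft] matula_graft
      polys_of_matula(1)[OF S_props(1)] polys_of_matula(1)[OF T_props(1)] S_props(2) T_props(2) by simp
  show "WP (m * nth_prime t) = WP m + WP t + monom 1 1 * (1 + PWP m) * (1 + PWP t)"
    using wiener_poly_graft[OF disjoint_trees_axioms] polys_of_matula(2)[OF rooted_tree_graft]
      matula_graft polys_of_matula[OF S_props(1)] polys_of_matula[OF T_props(1)] S_props(2) T_props(2) by simp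
qed

lemma polys_nth_prime:
  assumes "1 \<le> t"
  shows "PWP (nth_prime t) = monom 1 1 * (1 + PWP t)"
    and "WP (nth_prime t) = WP t + monom 1 1 * (1 + PWP t)"
  using polys_mult_nth_prime[of 1 t] assms polys_one by simp_all

text \<open>With \<open>s = m p\<^sub>t\<close>, the step compares the grafts onto the trees of \<open>r m\<close> and of \<open>m\<close>: the cross
  terms \<open>x (1 + Q(r m)) (1 + Q(t))\<close> and \<open>x (1 + Q(m)) (1 + Q(t))\<close> differ by
  \<open>Q(r) x (1 + Q(t))\<close>, which is exactly \<open>Q(r) (Q(s) - Q(m))\<close>.\<close>

lemma polys_mult:
  assumes "1 \<le> r" "1 \<le> s"
  shows "PWP (r * s) = PWP r + PWP s \<and> WP (r * s) = WP r + WP s + PWP r * PWP s"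
  using assms(2)
proof (induction s rule: less_induct)
  case (less s)
  show ?case
  proof (cases "s = 1")
    case True
    then show ?thesis using polys_one by simp
  next
    case False
    then obtain p where p: "prime p" "p dvd s" using prime_factor_nat by blast
    then obtain t where t: "1 \<le> t" "p = nth_prime t" using prime_is_nth_prime by blast
    obtain m where m: "s = m * nth_prime t" using p(2) t(2) by (metis dvd_def mult.commute)
    have m1: "1 \<le> m" using m less.prems by (cases m) auto
    have "m < s" using m m1 prime_gt_1_nat[OF prime_nth_prime[of t]] by simp
    note IH = less.IH[OF this m1]
    have rm: "1 \<le> r * m" using assms(1) m1 by simp
    have "r * s = (r * m) * nth_prime t" using m by simp
    then show ?thesis
      using IH m polys_mult_nth_prime[OF rm t(1)] polys_mult_nth_prime[OF m1 t(1)]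
      by (simp add: algebra_simps)
  qed
qed

theorem proposition3p26:
  fixes n :: nat
  assumes "n \<ge> 1"
  shows "(n = 1 \<longrightarrow> WP n = 0) \<and>
         (\<forall>t\<ge>1. n = nth_prime t \<longrightarrow> WP n = WP t + monom 1 1 * PWP t + monom 1 1) \<and>
         (\<forall>r\<ge>2. \<forall>s\<ge>2. n = r * s \<longrightarrow> WP n = WP r + WP s + PWP r * PWP s)"
proof (intro conjI allI impI)
  show "WP n = 0" if "n = 1" using that polys_one by simp
  show "WP n = WP t + monom 1 1 * PWP t + monom 1 1" if "1 \<le> t" "n = nth_prime t" for t
    using that polys_nth_prime(2)[of t] by (simp add: algebra_simps)
  show "WP n = WP r + WP s + PWP r * PWP s" if "2 \<le> r" "2 \<le> s" "n = r * s" for r s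
    using that polys_mult[of r s] by simp
qed

end
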